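(* Let $n$ and $r$ be positive integers with $1 \le r \le n-1$, and let $f(n,r)$ denote the minimum integer such that every connected graph $G$ of order $n$ with $e(G) \ge f(n,r)$ satisfies $md(G) \le r$. Then $$f(n,r) = \begin{cases} \binom{n-r+1}{2} - n + 2r + 1 & \text{if } 1 \le r \le n-2; \\ n-1 & \text{if } r = n-1. \end{cases}$$
   Context: All graphs are finite and simple; $e(G)$ denotes the number of edges of $G$. An edge-coloring of a graph $G$ is a map $\Gamma: E(G) \to [k]$ (adjacent edges may receive the same color); $|\Gamma|$ is the number of colors used. An edge-cut is monochromatic if all of its edges have the same color. An edge-coloring of $G$ is a monochromatic disconnection coloring (MD-coloring) if any two distinct vertices $u,v$ of $G$ are separated by a monochromatic edge-cut (equivalently, for some color $i$, $u$ and $v$ lie in different components of the graph obtained from $G$ by deleting all edges of color $i$). For a connected graph $G$, the monochromatic disconnection number $md(G)$ is the maximum number of colors in an MD-coloring of $G$.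
   Formalization: The minimum defining f(n,r) is taken over integers at least n-1, because for r = n-1 every integer satisfies the condition and no minimum exists; for r ≤ n-2 this changes nothing. Graphs have natural numbers as vertices, which covers all finite graphs up to isomorphism. *)

theory Defs
  imports Complex_Main
begin

text \<open>A finite simple graph is given by its vertex set \<open>V\<close> and its edge set \<open>E\<close>,
  the edges being two-element subsets of \<open>V\<close>.\<close>

definition simple_graph :: "'a set \<Rightarrow> 'a set set \<Rightarrow> bool" where
  "simple_graph V E \<longleftrightarrow> finite V \<and> (\<forall>e\<in>E. e \<subseteq> V \<and> card e = 2)"

definition reachable :: "'a set set \<Rightarrow> 'a \<Rightarrow> 'a \<Rightarrow> bool" where
  "reachable E u v \<longleftrightarrow> (u, v) \<in> {(x, y). {x, y} \<in> E}\<^sup>*"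

definition connected_graph :: "'a set \<Rightarrow> 'a set set \<Rightarrow> bool" where
  "connected_graph V E \<longleftrightarrow> V \<noteq> {} \<and> (\<forall>u\<in>V. \<forall>v\<in>V. reachable E u v)"

definition edge_cut :: "'a set \<Rightarrow> 'a set set \<Rightarrow> 'a set set \<Rightarrow> bool" where
  "edge_cut V E F \<longleftrightarrow> F \<subseteq> E \<and> \<not> connected_graph V (E - F)"

definition separates :: "'a set set \<Rightarrow> 'a set set \<Rightarrow> 'a \<Rightarrow> 'a \<Rightarrow> bool" where
  "separates E F u v \<longleftrightarrow> \<not> reachable (E - F) u v"

text \<open>Colors are natural numbers and \<open>[k] = {1..k}\<close>. A coloring is a total function on sets of
  vertices, of which only the values on \<open>E\<close> matter.\<close>

definition edge_coloring :: "nat \<Rightarrow> 'a set set \<Rightarrow> ('a set \<Rightarrow> nat) \<Rightarrow> bool" where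
  "edge_coloring k E \<Gamma> \<longleftrightarrow> (\<forall>e\<in>E. \<Gamma> e \<in> {1..k})"

definition num_colors :: "'a set set \<Rightarrow> ('a set \<Rightarrow> nat) \<Rightarrow> nat" where
  "num_colors E \<Gamma> = card (\<Gamma> ` E)"

definition monochromatic :: "('a set \<Rightarrow> nat) \<Rightarrow> 'a set set \<Rightarrow> bool" where
  "monochromatic \<Gamma> F \<longleftrightarrow> (\<forall>e\<in>F. \<forall>e'\<in>F. \<Gamma> e = \<Gamma> e')"

definition MD_coloring :: "'a set \<Rightarrow> 'a set set \<Rightarrow> ('a set \<Rightarrow> nat) \<Rightarrow> bool" where
  "MD_coloring V E \<Gamma> \<longleftrightarrow>
     (\<exists>k. edge_coloring k E \<Gamma>) \<and>
     (\<forall>u\<in>V. \<forall>v\<in>V. u \<noteq> v \<longrightarrow>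
        (\<exists>F. edge_cut V E F \<and> monochromatic \<Gamma> F \<and> separates E F u v))"

definition md :: "'a set \<Rightarrow> 'a set set \<Rightarrow> nat" where
  "md V E = Max {num_colors E \<Gamma> | \<Gamma>. MD_coloring V E \<Gamma>}"

text \<open>\<open>edge_bound n r m\<close>: every connected graph of order \<open>n\<close> with at least \<open>m\<close> edges has
  \<open>md \<le> r\<close>. Up to isomorphism, every finite graph has its vertices in \<^typ>\<open>nat\<close>.\<close>

definition edge_bound :: "nat \<Rightarrow> nat \<Rightarrow> int \<Rightarrow> bool" where
  "edge_bound n r m \<longleftrightarrow>
     (\<forall>(V :: nat set) E. simple_graph V E \<and> connected_graph V E \<and> card V = n \<and> int (card E) \<ge> m
        \<longrightarrow> md V E \<le> r)"

text \<open>Connected graphs of order \<open>n\<close> have at least \<open>n - 1\<close> edges, so all integers \<open>m \<le> n - 1\<close> give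
  the same condition \<open>edge_bound n r m\<close>. The minimum is taken over \<open>m \<ge> n - 1\<close>: for \<open>r = n - 1\<close>
  the condition holds for every integer, and there would be no minimum otherwise. For
  \<open>r \<le> n - 2\<close> the restriction has no effect, because trees have \<open>md = n - 1\<close>.\<close>

definition md_edge_threshold :: "nat \<Rightarrow> nat \<Rightarrow> int" where
  "md_edge_threshold n r = (LEAST m. m \<ge> int n - 1 \<and> edge_bound n r m)"

text \<open>The maximum defining \<^const>\<open>md\<close> and the minimum defining \<^const>\<open>md_edge_threshold\<close> are attained, and
  \<^const>\<open>MD_coloring\<close> agrees with the description by deletion of a color class.\<close>

lemma finite_num_colors:
  assumes "simple_graph V E"
  shows "finite {num_colors E \<Gamma> | \<Gamma>. MD_coloring V E \<Gamma>}"
proof -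
  have "finite E"
    using assms unfolding simple_graph_def by (auto intro: finite_subset[of E "Pow V"])
  then have "{num_colors E \<Gamma> | \<Gamma>. MD_coloring V E \<Gamma>} \<subseteq> {..card E}"
    by (auto simp: num_colors_def card_image_le)
  then show ?thesis by (rule finite_subset) simp
qed

lemma reachable_empty: "reachable {} u v \<longleftrightarrow> u = v"
  unfolding reachable_def by simp

lemma MD_coloring_const: "MD_coloring V E (\<lambda>_. 1)"
proof -
  have "edge_coloring 1 E (\<lambda>_. 1)" by (simp add: edge_coloring_def)
  moreover have "\<exists>F. edge_cut V E F \<and> monochromatic (\<lambda>_. 1) F \<and> separates E F u v"
    if "u \<in> V" "v \<in> V" "u \<noteq> v" for u v
    using that by (intro exI[of _ E])
      (auto simp: edge_cut_def connected_graph_def monochromatic_def separates_def reachable_empty)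
  ultimately show ?thesis unfolding MD_coloring_def by blast
qed

lemma md_attained:
  assumes "simple_graph V E"
  obtains \<Gamma> where "MD_coloring V E \<Gamma>" "num_colors E \<Gamma> = md V E"
proof -
  have "md V E \<in> {num_colors E \<Gamma> | \<Gamma>. MD_coloring V E \<Gamma>}"
    unfolding md_def using finite_num_colors[OF assms] MD_coloring_const[of V E]
    by (intro Max_in) blast+
  then show ?thesis using that by auto
qed

lemma num_colors_le_md:
  assumes "simple_graph V E" "MD_coloring V E \<Gamma>"
  shows "num_colors E \<Gamma> \<le> md V E"
  unfolding md_def using finite_num_colors[OF assms(1)] assms(2) by (intro Max_ge) auto

lemma reachable_mono:
  assumes "reachable E u v" "E \<subseteq> E'"
  shows "reachable E' u v"
proof -
  have "{(x, y). {x, y} \<in> E}\<^sup>* \<subseteq> {(x, y). {x, y} \<in> E'}\<^sup>*"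
    using assms(2) by (intro rtrancl_mono) auto
  then show ?thesis using assms(1) unfolding reachable_def by blast
qed

lemma MD_coloring_iff:
  assumes "connected_graph V E"
  shows "MD_coloring V E \<Gamma> \<longleftrightarrow>
     (\<exists>k. edge_coloring k E \<Gamma>) \<and>
     (\<forall>u\<in>V. \<forall>v\<in>V. u \<noteq> v \<longrightarrow> (\<exists>i. \<not> reachable {e \<in> E. \<Gamma> e \<noteq> i} u v))"
proof -
  have "(\<exists>F. edge_cut V E F \<and> monochromatic \<Gamma> F \<and> separates E F u v) \<longleftrightarrow>
        (\<exists>i. \<not> reachable {e \<in> E. \<Gamma> e \<noteq> i} u v)" if uv: "u \<in> V" "v \<in> V" for u v
  proof
    assume "\<exists>F. edge_cut V E F \<and> monochromatic \<Gamma> F \<and> separates E F u v"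
    then obtain F where F: "edge_cut V E F" "monochromatic \<Gamma> F" "separates E F u v"
      by (elim exE conjE)
    have "reachable E u v" using assms uv unfolding connected_graph_def by simp
    then have "F \<noteq> {}" using F(3) unfolding separates_def by (metis Diff_empty)
    then obtain e where e: "e \<in> F" by (meson ex_in_conv)
    have "{e' \<in> E. \<Gamma> e' \<noteq> \<Gamma> e} \<subseteq> E - F"
      using F(2) e unfolding monochromatic_def by blast
    then have "\<not> reachable {e' \<in> E. \<Gamma> e' \<noteq> \<Gamma> e} u v"
      using F(3) reachable_mono[of "{e' \<in> E. \<Gamma> e' \<noteq> \<Gamma> e}" u v "E - F"]
      unfolding separates_def by (elim contrapos_nn)
    then show "\<exists>i. \<not> reachable {e \<in> E. \<Gamma> e \<noteq> i} u v" by (rule exI)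
  next
    assume "\<exists>i. \<not> reachable {e \<in> E. \<Gamma> e \<noteq> i} u v"
    then obtain i where i: "\<not> reachable {e \<in> E. \<Gamma> e \<noteq> i} u v" by (elim exE)
    define F where "F = {e \<in> E. \<Gamma> e = i}"
    have "E - F = {e \<in> E. \<Gamma> e \<noteq> i}" unfolding F_def by blast
    then have "\<not> reachable (E - F) u v" using i by simp
    moreover have "F \<subseteq> E" unfolding F_def by blast
    moreover have "monochromatic \<Gamma> F" unfolding F_def monochromatic_def by simp
    moreover have "\<not> connected_graph V (E - F)"
      using \<open>\<not> reachable (E - F) u v\<close> uv unfolding connected_graph_def by metis
    ultimately have "edge_cut V E F \<and> monochromatic \<Gamma> F \<and> separates E F u v"
      unfolding edge_cut_def separates_def by simp
    then show "\<exists>F. edge_cut V E F \<and> monochromatic \<Gamma> F \<and> separates E F u v" by (rule exI)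
  qed
  then show ?thesis unfolding MD_coloring_def by simp
qed

lemma edge_bound_exists: "\<exists>m \<ge> int n - 1. edge_bound n r m"
proof -
  have "edge_bound n r (2 ^ n + int n)"
    unfolding edge_bound_def
  proof (intro allI impI)
    fix V :: "nat set" and E
    assume *: "simple_graph V E \<and> connected_graph V E \<and> card V = n \<and> 2 ^ n + int n \<le> int (card E)"
    then have fin: "finite V" and "E \<subseteq> Pow V" by (auto simp: simple_graph_def)
    then have "card E \<le> 2 ^ n" using * by (metis card_Pow card_mono finite_Pow_iff)
    then have "int (card E) \<le> 2 ^ n" by (metis of_nat_le_iff of_nat_numeral of_nat_power)
    then have "n = 0" using * by linarith
    then show "md V E \<le> r" using * fin by (auto simp: connected_graph_def)
  qed
  moreover have "(0::int) \<le> 2 ^ n" by simp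
  then have "int n - 1 \<le> 2 ^ n + int n" by linarith
  ultimately show ?thesis by blast
qed

lemma md_edge_threshold_least:
  "md_edge_threshold n r \<ge> int n - 1" "edge_bound n r (md_edge_threshold n r)"
  "m \<ge> int n - 1 \<Longrightarrow> edge_bound n r m \<Longrightarrow> md_edge_threshold n r \<le> m"
proof -
  let ?P = "\<lambda>k. edge_bound n r (int n - 1 + int k)"
  obtain m0 where "m0 \<ge> int n - 1" "edge_bound n r m0" using edge_bound_exists by blast
  then have ex: "?P (nat (m0 - (int n - 1)))" by simp
  have eq: "md_edge_threshold n r = int n - 1 + int (LEAST k. ?P k)"
    unfolding md_edge_threshold_def
  proof (rule Least_equality)
    show "int n - 1 \<le> int n - 1 + int (LEAST k. ?P k) \<and>
          edge_bound n r (int n - 1 + int (LEAST k. ?P k))"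
      using LeastI[of ?P, OF ex] by simp
  next
    fix y assume "int n - 1 \<le> y \<and> edge_bound n r y"
    then have "?P (nat (y - (int n - 1)))" and "int n - 1 \<le> y" by simp_all
    then show "int n - 1 + int (LEAST k. ?P k) \<le> y"
      using Least_le[of ?P "nat (y - (int n - 1))"] by linarith
  qed
  show "md_edge_threshold n r \<ge> int n - 1" using eq by simp
  show "edge_bound n r (md_edge_threshold n r)" using LeastI[of ?P, OF ex] eq by simp
  show "md_edge_threshold n r \<le> m" if "m \<ge> int n - 1" "edge_bound n r m"
  proof -
    have "?P (nat (m - (int n - 1)))" using that by simp
    then show ?thesis using Least_le[of ?P "nat (m - (int n - 1))"] eq that by linarith
  qed
qed

end

theory Submission imports Defs begin

text \<open>For a connected vertex set \<open>U\<close> carrying \<open>k\<close> colors, every vertex \<open>v\<close> with \<open>U - {v}\<close> connected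
  has at most \<open>|U| - k\<close> neighbors in \<open>U\<close>, and at most one if some color occurs only at \<open>v\<close>.
  Deleting such vertices one by one gives
  \<open>e(U) \<le> (|U| - k + 1 choose 2) + k - 1\<close>, which is decreasing in \<open>k\<close>. The bound is attained by a
  clique on \<open>n - r\<close> vertices with \<open>r\<close> pendant edges, each of its own color.

  The degree bound rests on two facts: the ends of an edge of color \<open>p\<close> are separated by no color
  other than \<open>p\<close>, and a vertex has at most one \<open>p\<close>-colored edge into each component of the graph
  without the color \<open>p\<close>.\<close>

section \<open>Reachability\<close>

lemma reachable_refl [simp]: "reachable E u u"
  by (simp add: reachable_def)

lemma reachable_trans: "reachable E u v \<Longrightarrow> reachable E v w \<Longrightarrow> reachable E u w"
  unfolding reachable_def by (rule rtrancl_trans)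

lemma reachable_edge: "{u, v} \<in> E \<Longrightarrow> reachable E u v"
  unfolding reachable_def by auto

lemma reachable_sym: "reachable E u v \<Longrightarrow> reachable E v u"
proof -
  have "sym {(x, y). {x, y} \<in> E}"
    by (auto simp: sym_def insert_commute)
  then show "reachable E u v \<Longrightarrow> reachable E v u"
    unfolding reachable_def by (meson sym_rtrancl symD)
qed

lemma reachable_step: "reachable E u v \<Longrightarrow> {v, w} \<in> E \<Longrightarrow> reachable E u w"
  by (rule reachable_trans[OF _ reachable_edge])

lemma reachable_common: "reachable E u x \<Longrightarrow> reachable E u y \<Longrightarrow> reachable E x y"
  by (rule reachable_trans[OF reachable_sym])

lemma reachable_closed:
  assumes "reachable E u v" "u \<in> A" "\<And>x y. x \<in> A \<Longrightarrow> {x, y} \<in> E \<Longrightarrow> y \<in> A"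
  shows "v \<in> A"
  using assms(1) unfolding reachable_def
  by (induction rule: rtrancl_induct) (use assms(2,3) in auto)

section \<open>Connected vertex sets and their cuts\<close>

definition induced :: "'a set set \<Rightarrow> 'a set \<Rightarrow> 'a set set" where
  "induced E W = {e \<in> E. e \<subseteq> W}"

definition conn :: "'a set set \<Rightarrow> 'a set \<Rightarrow> bool" where
  "conn E W \<longleftrightarrow> connected_graph W (induced E W)"

text \<open>A set with no outgoing edge traps everything reachable from it; conversely, the set of
  vertices reachable from \<open>u\<close> inside \<open>W\<close> has no outgoing edge. The cut
  form lets later arguments pick one crossing edge instead of handling paths.\<close>

lemma conn_iff_cuts:
  "conn E W \<longleftrightarrow>
     W \<noteq> {} \<and> (\<forall>A\<subseteq>W. A \<noteq> {} \<and> A \<noteq> W \<longrightarrow> (\<exists>x\<in>A. \<exists>y\<in>W - A. {x, y} \<in> E))"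
proof (intro iffI conjI allI impI)
  fix A assume W: "conn E W" and A: "A \<subseteq> W" "A \<noteq> {} \<and> A \<noteq> W"
  then obtain a b where ab: "a \<in> A" "b \<in> W - A" by blast
  then have "reachable (induced E W) a b"
    using W A unfolding conn_def connected_graph_def by blast
  show "\<exists>x\<in>A. \<exists>y\<in>W - A. {x, y} \<in> E"
  proof (rule ccontr)
    assume "\<not> ?thesis"
    then have "b \<in> A"
      using reachable_closed[OF \<open>reachable (induced E W) a b\<close> ab(1)]
      by (auto simp: induced_def)
    with ab show False by blast
  qed
next
  assume "conn E W" then show "W \<noteq> {}" by (simp add: conn_def connected_graph_def)
next
  assume W: "W \<noteq> {} \<and> (\<forall>A\<subseteq>W. A \<noteq> {} \<and> A \<noteq> W \<longrightarrow> (\<exists>x\<in>A. \<exists>y\<in>W - A. {x, y} \<in> E))"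
  have "reachable (induced E W) u v" if uv: "u \<in> W" "v \<in> W" for u v
  proof (rule ccontr)
    assume *: "\<not> ?thesis"
    define A where "A = {x \<in> W. reachable (induced E W) u x}"
    have "A \<subseteq> W" "A \<noteq> {}" "A \<noteq> W" using uv * unfolding A_def by auto
    then obtain x y where xy: "x \<in> A" "y \<in> W - A" "{x, y} \<in> E" using W by meson
    then have "{x, y} \<in> induced E W" unfolding induced_def A_def by auto
    then have "reachable (induced E W) u y"
      using xy(1) reachable_step unfolding A_def by fast
    then show False using xy(2) unfolding A_def by blast
  qed
  then show "conn E W" using W unfolding conn_def connected_graph_def by blast
qed

lemma conn_out_edge:
  assumes "conn E W" "A \<subseteq> W" "A \<noteq> {}" "A \<noteq> W"
  obtains x y where "x \<in> A" "y \<in> W - A" "{x, y} \<in> E"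
  using assms unfolding conn_iff_cuts by meson

lemma not_connE:
  assumes "\<not> conn E W" "W \<noteq> {}"
  obtains A where "A \<subseteq> W" "A \<noteq> {}" "A \<noteq> W" "\<forall>x\<in>A. \<forall>y\<in>W - A. {x, y} \<notin> E"
proof -
  have "\<exists>A\<subseteq>W. (A \<noteq> {} \<and> A \<noteq> W) \<and> \<not> (\<exists>x\<in>A. \<exists>y\<in>W - A. {x, y} \<in> E)"
    using assms unfolding conn_iff_cuts by simp
  then show ?thesis using that by (elim exE conjE) simp
qed

lemma conn_nonempty: "conn E W \<Longrightarrow> W \<noteq> {}"
  by (simp add: conn_def connected_graph_def)

lemma conn_singleton: "conn E {v}"
  by (auto simp: conn_iff_cuts)

lemma conn_attach:
  assumes W: "conn E W" and Y: "\<And>y. y \<in> Y \<Longrightarrow> \<exists>x\<in>W. {x, y} \<in> E"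
  shows "conn E (W \<union> Y)"
proof -
  have W0: "W \<noteq> {}" by (rule conn_nonempty[OF W])
  have "\<exists>x\<in>A. \<exists>y\<in>W \<union> Y - A. {x, y} \<in> E"
    if A: "A \<subseteq> W \<union> Y" "A \<noteq> {}" "A \<noteq> W \<union> Y" for A
  proof -
    consider "A \<inter> W = {}" | "W \<subseteq> A" | "A \<inter> W \<noteq> {}" "A \<inter> W \<noteq> W" by blast
    then show ?thesis
    proof cases
      case 1
      then obtain a where a: "a \<in> A" "a \<in> Y" using A by blast
      from Y[OF a(2)] obtain x where "x \<in> W" "{a, x} \<in> E" by (auto simp: insert_commute)
      then show ?thesis using 1 a by blast
    next
      case 2
      then obtain b where b: "b \<in> Y" "b \<notin> A" using A by blast
      then show ?thesis using Y[OF b(1)] 2 by blast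
    next
      case 3
      then obtain x y where "x \<in> A \<inter> W" "y \<in> W - A \<inter> W" "{x, y} \<in> E"
        using conn_out_edge[OF W, of "A \<inter> W"] by blast
      then show ?thesis by blast
    qed
  qed
  then show ?thesis using W0 unfolding conn_iff_cuts by blast
qed

text \<open>A part containing a vertex of the component, with no edge of \<open>E\<close> to the
  rest of it, is closed under \<open>F\<close>, hence is the whole component. This supplies the
  connected set that remains around a vertex once a color is deleted.\<close>

lemma conn_reachable_set:
  assumes "F \<subseteq> E"
  shows "conn E {x. reachable F v x}"
proof -
  let ?L = "{x. reachable F v x}"
  have "\<exists>x\<in>A. \<exists>y\<in>?L - A. {x, y} \<in> E" if A: "A \<subseteq> ?L" "A \<noteq> {}" "A \<noteq> ?L" for A
  proof (rule ccontr)
    assume no: "\<not> ?thesis"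
    have closed: "y \<in> A" if "x \<in> A" "{x, y} \<in> F" for x y
    proof -
      have "reachable F v y" using reachable_step[of F v x y] that A by blast
      then show ?thesis using no that assms by blast
    qed
    obtain a b where ab: "a \<in> A" "b \<in> ?L" "b \<notin> A" using A by blast
    then have "reachable F a b" using A reachable_common[of F v a b] by blast
    then have "b \<in> A" by (rule reachable_closed) (use ab closed in blast)+
    then show False using ab by blast
  qed
  moreover have "v \<in> ?L" by simp
  ultimately show ?thesis unfolding conn_iff_cuts by blast
qed

lemma conn_branch:
  assumes U: "conn E U" and v: "v \<in> U" and AB: "U - {v} = A \<union> B" "A \<inter> B = {}"
    and no: "\<And>x y. x \<in> A \<Longrightarrow> y \<in> B \<Longrightarrow> {x, y} \<notin> E"
  shows "conn E (insert v B)"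
proof -
  have "\<exists>x\<in>C. \<exists>y\<in>insert v B - C. {x, y} \<in> E"
    if C: "C \<subseteq> insert v B" "C \<noteq> {}" "C \<noteq> insert v B" for C
  proof (cases "v \<in> C")
    case True
    \<comment> \<open>Adding \<open>A\<close> to \<open>C\<close> forces the crossing edge of
      \<open>U\<close> to end in \<open>B\<close>; it cannot start in \<open>A\<close>, as no edge
      joins \<open>A\<close> to \<open>B\<close>.\<close>
    have "A \<union> C \<subseteq> U" "A \<union> C \<noteq> {}" "A \<union> C \<noteq> U" using AB v C True by blast+
    then obtain x y where xy: "x \<in> A \<union> C" "y \<in> U - (A \<union> C)" "{x, y} \<in> E"
      by (rule conn_out_edge[OF U])
    have "y \<in> B" using xy(2) AB True by blast
    then have "x \<in> C" using no xy by blast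
    then show ?thesis using xy \<open>y \<in> B\<close> by blast
  next
    case False
    have "C \<subseteq> U" "C \<noteq> U" using AB v C False by blast+
    then obtain x y where xy: "x \<in> C" "y \<in> U - C" "{x, y} \<in> E"
      using conn_out_edge[OF U _ C(2)] by metis
    have "x \<in> B" using xy(1) C False by blast
    then have "y \<notin> A" using no[of y x] xy(3) by (auto simp: insert_commute)
    then show ?thesis using xy AB by blast
  qed
  then show ?thesis unfolding conn_iff_cuts by blast
qed

text \<open>A maximal connected proper subset can be enlarged by one vertex along a crossing edge;
  by maximality the result is all of \<open>U\<close>, so exactly one vertex was missing.\<close>

lemma conn_delete_vertex:
  assumes "finite U" "conn E U" "card U \<ge> 2"
  obtains v where "v \<in> U" "conn E (U - {v})"
proof -
  let ?S = "{W. W \<subset> U \<and> conn E W}"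
  obtain u where "u \<in> U" using assms(3) by fastforce
  moreover have "U \<noteq> {u}" using assms(3) by auto
  ultimately have "{u} \<in> ?S" using conn_singleton[of E u] by blast
  moreover have "finite ?S" by (rule finite_subset[of _ "Pow U"]) (use assms(1) in auto)
  ultimately have "\<exists>W\<in>?S. \<forall>W'\<in>?S. W \<subseteq> W' \<longrightarrow> W = W'"
    by (intro finite_has_maximal) auto
  then obtain W where W: "W \<in> ?S" and max: "\<forall>W'\<in>?S. W \<subseteq> W' \<longrightarrow> W = W'" ..
  have "W \<subseteq> U" "W \<noteq> {}" "W \<noteq> U" using W conn_nonempty[of E W] by auto
  then obtain x y where xy: "x \<in> W" "y \<in> U - W" "{x, y} \<in> E"
    by (rule conn_out_edge[OF assms(2)])
  have "conn E (W \<union> {y})" by (rule conn_attach) (use W xy in blast)+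
  then have "W \<union> {y} = U" using max W xy by blast
  then have "U - {y} = W" using xy by blast
  then show ?thesis using that[of y] W xy by blast
qed

section \<open>Colorings that separate every pair of vertices\<close>

text \<open>Separation always refers to the whole edge set \<open>E\<close>, while colors and
  connectivity are studied on vertex subsets; inductions thus pass to subsets under one fixed
  coloring.\<close>

locale md_colored_graph =
  fixes V :: "'a set" and E :: "'a set set" and \<Gamma> :: "'a set \<Rightarrow> nat"
  assumes simple: "simple_graph V E"
    and separated: "u \<in> V \<Longrightarrow> v \<in> V \<Longrightarrow> u \<noteq> v \<Longrightarrow> \<exists>i. \<not> reachable {e \<in> E. \<Gamma> e \<noteq> i} u v"
begin

lemma finite_V: "finite V"
  using simple by (simp add: simple_graph_def)

lemma finite_E: "finite E"
  using simple unfolding simple_graph_def by (auto intro: finite_subset[of E "Pow V"])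

lemma edgeD: "{x, y} \<in> E \<Longrightarrow> x \<in> V \<and> y \<in> V \<and> x \<noteq> y"
  using simple unfolding simple_graph_def by (force simp: card_2_iff)

lemma edgeE:
  assumes "e \<in> E"
  obtains x y where "e = {x, y}"
proof -
  have "card e = 2" using simple assms by (simp add: simple_graph_def)
  then show ?thesis using that by (auto simp: card_2_iff)
qed

definition nbrs :: "'a set \<Rightarrow> 'a \<Rightarrow> 'a set" where
  "nbrs U v = {u \<in> U. {u, v} \<in> E}"

definition colors :: "'a set \<Rightarrow> nat set" where
  "colors U = \<Gamma> ` induced E U"

lemma finite_colors [simp]: "finite (colors U)"
  using finite_E by (simp add: colors_def induced_def)

lemma colors_mono: "U \<subseteq> W \<Longrightarrow> colors U \<subseteq> colors W"
  by (auto simp: colors_def induced_def)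

lemma colorsE:
  assumes "c \<in> colors U"
  obtains x y where "x \<in> U" "y \<in> U" "{x, y} \<in> E" "\<Gamma> {x, y} = c"
proof -
  obtain e where e: "e \<in> E" "e \<subseteq> U" "\<Gamma> e = c" using assms by (auto simp: colors_def induced_def)
  from e(1) obtain x y where "e = {x, y}" by (rule edgeE)
  then show ?thesis using e that by blast
qed

lemma colorsI: "x \<in> U \<Longrightarrow> y \<in> U \<Longrightarrow> {x, y} \<in> E \<Longrightarrow> \<Gamma> {x, y} \<in> colors U"
  by (auto simp: colors_def induced_def)

text \<open>Deleting any color other than its own leaves the edge in place, so the color separating
  its ends must be its own.\<close>

lemma edge_separated:
  assumes "{x, y} \<in> E"
  shows "\<not> reachable {e \<in> E. \<Gamma> e \<noteq> \<Gamma> {x, y}} x y"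
proof -
  obtain i where i: "\<not> reachable {e \<in> E. \<Gamma> e \<noteq> i} x y"
    using separated[of x y] edgeD[OF assms] by blast
  then have "\<Gamma> {x, y} = i" using reachable_edge[of x y "{e \<in> E. \<Gamma> e \<noteq> i}"] assms by blast
  then show ?thesis using i by simp
qed

text \<open>A color \<open>i\<close> separating \<open>x\<close> from \<open>x'\<close> is not
  \<open>p\<close>, since deleting \<open>p\<close> leaves them joined; but the two
  \<open>p\<close>-edges at \<open>y\<close> survive the deletion of \<open>i\<close>.\<close>

lemma color_neighbor_unique:
  assumes "reachable {e \<in> E. \<Gamma> e \<noteq> p} x x'"
    and "{x, y} \<in> E" "\<Gamma> {x, y} = p" "{x', y} \<in> E" "\<Gamma> {x', y} = p"
  shows "x = x'"
proof (rule ccontr)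
  assume "x \<noteq> x'"
  then obtain i where i: "\<not> reachable {e \<in> E. \<Gamma> e \<noteq> i} x x'"
    using separated[of x x'] edgeD[OF assms(2)] edgeD[OF assms(4)] by blast
  then have "p \<noteq> i" using assms(1) by blast
  then have "reachable {e \<in> E. \<Gamma> e \<noteq> i} x y" "reachable {e \<in> E. \<Gamma> e \<noteq> i} x' y"
    using assms by (auto intro!: reachable_edge)
  from reachable_trans[OF this(1) reachable_sym[OF this(2)]] show False using i by blast
qed

lemma conn_reachable_avoiding:
  assumes "conn E W" "x \<in> W" "y \<in> W" "j \<notin> colors W"
  shows "reachable {e \<in> E. \<Gamma> e \<noteq> j} x y"
proof -
  have "induced E W \<subseteq> {e \<in> E. \<Gamma> e \<noteq> j}"
    using assms(4) by (auto simp: colors_def induced_def)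
  moreover have "reachable (induced E W) x y"
    using assms by (simp add: conn_def connected_graph_def)
  ultimately show ?thesis by (rule reachable_mono[rotated])
qed

text \<open>An edge whose color is new cannot have its ends joined by edges of other colors.\<close>

lemma colors_attach:
  assumes W: "conn E W" and Y: "\<And>y. y \<in> Y \<Longrightarrow> \<exists>x\<in>W. {x, y} \<in> E \<and> \<Gamma> {x, y} = p"
  shows "colors (W \<union> Y) \<subseteq> insert p (colors W)"
proof
  fix c assume "c \<in> colors (W \<union> Y)"
  then obtain x y where xy: "x \<in> W \<union> Y" "y \<in> W \<union> Y" "{x, y} \<in> E" "\<Gamma> {x, y} = c"
    by (rule colorsE)
  show "c \<in> insert p (colors W)"
  proof (rule ccontr)
    assume c: "c \<notin> insert p (colors W)"
    \<comment> \<open>As \<open>p\<close> differs from \<open>c\<close>, the \<open>p\<close>-edge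
      of a vertex of \<open>Y\<close> survives the deletion of \<open>c\<close>, and no edge inside
      \<open>W\<close> has color \<open>c\<close>. Together these join the ends of the edge
      \<open>{x, y}\<close> without using its own color.\<close>
    have reach: "\<exists>w\<in>W. reachable {e \<in> E. \<Gamma> e \<noteq> c} w z" if z: "z \<in> W \<union> Y" for z
    proof (cases "z \<in> W")
      case True then show ?thesis by (intro bexI[of _ z]) auto
    next
      case False
      then obtain w where "w \<in> W" "{w, z} \<in> E" "\<Gamma> {w, z} = p" using Y z by blast
      then show ?thesis using c by (auto intro!: bexI[of _ w] reachable_edge)
    qed
    obtain a b where ab: "a \<in> W" "b \<in> W" "reachable {e \<in> E. \<Gamma> e \<noteq> c} a x"
      "reachable {e \<in> E. \<Gamma> e \<noteq> c} b y"
      using reach xy by meson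
    have "reachable {e \<in> E. \<Gamma> e \<noteq> c} a b"
      using conn_reachable_avoiding[OF W ab(1,2)] c by blast
    then have "reachable {e \<in> E. \<Gamma> e \<noteq> c} x y"
      by (rule reachable_common[OF ab(3) reachable_trans[OF _ ab(4)]])
    then show False using edge_separated xy by blast
  qed
qed

section \<open>Numbers of colors and degree bounds\<close>

text \<open>\<open>W\<close> grows to \<open>U\<close> one vertex at a time across an edge, and by
  \<open>colors_attach\<close> each new vertex brings at most one new color.\<close>

lemma card_colors_extend:
  assumes "conn E U" "U \<subseteq> V" "conn E W" "W \<subseteq> U"
  shows "card (colors U) + card W \<le> card (colors W) + card U"
  using assms(3,4)
proof (induction "card (U - W)" arbitrary: W rule: less_induct)
  case less
  have fin: "finite U" by (rule finite_subset[OF assms(2) finite_V])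
  show ?case
  proof (cases "W = U")
    case False
    moreover have "W \<noteq> {}" by (rule conn_nonempty[OF less(2)])
    ultimately obtain x y where xy: "x \<in> W" "y \<in> U - W" "{x, y} \<in> E"
      using conn_out_edge[OF assms(1) less(3)] by blast
    have W': "conn E (W \<union> {y})" by (rule conn_attach[OF less(2)]) (use xy in blast)
    have "colors (W \<union> {y}) \<subseteq> insert (\<Gamma> {x, y}) (colors W)"
      by (rule colors_attach[OF less(2)]) (use xy in blast)
    then have "card (colors (W \<union> {y})) \<le> card (insert (\<Gamma> {x, y}) (colors W))"
      by (intro card_mono) auto
    also have "\<dots> \<le> Suc (card (colors W))" by (simp add: card_insert_if)
    finally have "card (colors (W \<union> {y})) \<le> Suc (card (colors W))" .
    moreover have "card (U - (W \<union> {y})) < card (U - W)"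
      by (rule psubset_card_mono) (use fin xy in auto)
    then have "card (colors U) + card (W \<union> {y}) \<le> card (colors (W \<union> {y})) + card U"
      by (rule less(1)[OF _ W']) (use less(3) xy in blast)
    moreover have "card (W \<union> {y}) = Suc (card W)"
      using xy finite_subset[OF less(3) fin] by simp
    ultimately show ?thesis by linarith
  qed simp
qed

lemma colors_singleton: "colors {v} = {}"
  using edgeD[of v v] by (auto elim!: colorsE)

lemma card_colors_less:
  assumes "conn E U" "U \<subseteq> V"
  shows "card (colors U) < card U"
proof -
  obtain u where "u \<in> U" using conn_nonempty[OF assms(1)] by blast
  then show ?thesis
    using card_colors_extend[OF assms conn_singleton[of E u]] by (simp add: colors_singleton)
qed

text \<open>The last assumption says that \<open>X\<close> meets every component of \<open>U - {v}\<close>. If \<open>U - {v}\<close> is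
  connected, let \<open>L\<close> be the component of \<open>v\<close> after deleting the color \<open>p\<close> of some edge at \<open>v\<close>,
  and apply the induction hypothesis to \<open>L\<close> with \<open>X\<close> replaced by the set \<open>Z\<close> of the other
  vertices of \<open>L\<close> that have an edge leaving \<open>L\<close>. All edges leaving \<open>L\<close> have color \<open>p\<close>, so
  vertices of \<open>L\<close> have distinct \<open>p\<close>-neighbors, and these add \<open>|Z|\<close> vertices, besides the
  \<open>p\<close>-neighbors of \<open>v\<close>, at the cost of one color.\<close>

lemma degree_bound_hitting_set:
  assumes "conn E U" "U \<subseteq> V" "v \<in> U" "X \<subseteq> U - {v}"
    and "\<And>W. W \<subseteq> U - {v} \<Longrightarrow> W \<noteq> {} \<Longrightarrow> W \<inter> X = {} \<Longrightarrow> \<exists>x\<in>W. \<exists>y\<in>U - {v} - W. {x, y} \<in> E"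
  shows "card (nbrs U v) + card (colors U) + 1 \<le> card U + card X"
  using assms
proof (induction "card U" arbitrary: U X rule: less_induct)
  case less
  note IH = less(1) and U = less(2,3,4) and X = less(5) and hit = less(6)
  have fin: "finite U" by (rule finite_subset[OF U(2) finite_V])
  have finX: "finite X" by (rule finite_subset[OF X]) (simp add: fin)
  show ?case
  proof (cases "U = {v}")
    case True
    have "nbrs U v = {}" using True edgeD[of v v] by (auto simp: nbrs_def)
    then show ?thesis using True by (simp add: colors_singleton)
  next
    case nontriv: False
    show ?thesis
    proof (cases "conn E (U - {v})")
      case conn: True
      \<comment> \<open>Otherwise \<open>U - {v}\<close> itself would miss \<open>X\<close> and need
        an edge leaving it inside \<open>U - {v}\<close>.\<close>
      have "X \<noteq> {}" using hit[of "U - {v}"] nontriv U by blast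
      then have X1: "card X \<ge> 1" using finX by (simp add: Suc_le_eq card_gt_0_iff)
      obtain m where m: "m \<in> U" "{v, m} \<in> E"
        using conn_out_edge[OF U(1), of "{v}"] nontriv U by blast
      define p where "p = \<Gamma> {v, m}"
      define F where "F = {e \<in> E. e \<subseteq> U \<and> \<Gamma> e \<noteq> p}"
      define L where "L = {x. reachable F v x}"
      have vL: "v \<in> L" by (simp add: L_def)
      have connL: "conn E L" unfolding L_def by (rule conn_reachable_set) (auto simp: F_def)
      have LU: "L \<subseteq> U"
      proof
        fix x assume "x \<in> L"
        then have "reachable F v x" by (simp add: L_def)
        then show "x \<in> U" by (rule reachable_closed) (use U in \<open>auto simp: F_def\<close>)
      qed
      have reachL: "reachable {e \<in> E. \<Gamma> e \<noteq> p} x y" if "x \<in> L" "y \<in> L" for x y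
      proof -
        have "reachable F x y" using that reachable_common[of F v x y] unfolding L_def by blast
        then show ?thesis by (rule reachable_mono) (auto simp: F_def)
      qed
      have outL: "y \<notin> L" if "x \<in> L" "{x, y} \<in> E" "\<Gamma> {x, y} = p" for x y
        using that reachL[of x y] edge_separated[of x y] by blast
      have exitL: "\<Gamma> {x, y} = p" if "x \<in> L" "y \<in> U - L" "{x, y} \<in> E" for x y
      proof (rule ccontr)
        assume "\<Gamma> {x, y} \<noteq> p"
        then have "{x, y} \<in> F" using that LU by (auto simp: F_def)
        then have "y \<in> L" using that(1) reachable_step[of F v x y] unfolding L_def by blast
        then show False using that by blast
      qed
      have mL: "m \<notin> L" using outL[OF vL m(2)] by (simp add: p_def)
      define Z where "Z = {x \<in> L - {v}. \<exists>y\<in>U - L. {x, y} \<in> E}"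
      have L_small: "card L < card U"
        by (rule psubset_card_mono) (use fin LU mL m in auto)
      have bound_L: "card (nbrs L v) + card (colors L) + 1 \<le> card L + card Z"
      proof (rule IH[OF L_small connL _ vL])
        show "L \<subseteq> V" using LU U by blast
        show "Z \<subseteq> L - {v}" by (auto simp: Z_def)
        fix W assume W: "W \<subseteq> L - {v}" "W \<noteq> {}" "W \<inter> Z = {}"
        \<comment> \<open>\<open>W\<close> misses \<open>m\<close>, so connectivity of
          \<open>U - {v}\<close> gives an edge leaving \<open>W\<close>; since \<open>W\<close>
          avoids \<open>Z\<close>, that edge stays in \<open>L\<close>.\<close>
        have "W \<subseteq> U - {v}" "W \<noteq> U - {v}" using W LU mL m vL by blast+
        then obtain x y where xy: "x \<in> W" "y \<in> U - {v} - W" "{x, y} \<in> E"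
          using conn_out_edge[OF conn _ W(2)] by metis
        have "y \<in> L" using W xy by (auto simp: Z_def)
        then show "\<exists>x\<in>W. \<exists>y\<in>L - {v} - W. {x, y} \<in> E" using xy by blast
      qed
      have "\<forall>x\<in>Z. \<exists>y. y \<in> U - L \<and> {x, y} \<in> E" by (auto simp: Z_def)
      then obtain f where f: "\<And>x. x \<in> Z \<Longrightarrow> f x \<in> U - L \<and> {x, f x} \<in> E" by metis
      have ZL: "x \<in> L" "x \<noteq> v" if "x \<in> Z" for x using that by (auto simp: Z_def)
      have fp: "\<Gamma> {x, f x} = p" if "x \<in> Z" for x using exitL f ZL that by blast
      define M where "M = {u \<in> U. {v, u} \<in> E \<and> \<Gamma> {v, u} = p}"
      have M_L: "M \<inter> L = {}" using outL[OF vL] by (auto simp: M_def)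
      have inj: "inj_on f Z"
      proof (rule inj_onI)
        fix x x' assume *: "x \<in> Z" "x' \<in> Z" "f x = f x'"
        show "x = x'"
          by (rule color_neighbor_unique[of p x x' "f x"])
            (use * f[of x] f[of x'] fp[of x] fp[of x'] reachL ZL in auto)
      qed
      have disj: "M \<inter> f ` Z = {}"
      proof (rule ccontr)
        assume "M \<inter> f ` Z \<noteq> {}"
        then obtain x where x: "x \<in> Z" "f x \<in> M" by blast
        have "x = v"
          by (rule color_neighbor_unique[of p x v "f x"])
            (use x f[of x] fp[of x] reachL ZL vL in \<open>auto simp: M_def\<close>)
        then show False using ZL x by blast
      qed
      define S where "S = L \<union> (M \<union> f ` Z)"
      have finL: "finite L" "finite M" "finite Z"
        using fin finite_subset[OF LU] by (auto simp: M_def Z_def)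
      have "card (M \<union> f ` Z) = card M + card Z"
        using finL disj inj by (simp add: card_Un_disjoint card_image)
      moreover have "L \<inter> (M \<union> f ` Z) = {}" using M_L f by blast
      ultimately have cardS: "card S = card L + card M + card Z"
        unfolding S_def using finL by (simp add: card_Un_disjoint)
      have att: "\<exists>x\<in>L. {x, y} \<in> E \<and> \<Gamma> {x, y} = p" if "y \<in> M \<union> f ` Z" for y
        using that f fp ZL vL unfolding M_def by blast
      have connS: "conn E S" unfolding S_def by (rule conn_attach[OF connL]) (use att in blast)
      have SU: "S \<subseteq> U" unfolding S_def M_def using LU f by blast
      have "colors S \<subseteq> insert p (colors L)" unfolding S_def by (rule colors_attach[OF connL att])
      then have "card (colors S) \<le> card (insert p (colors L))" by (intro card_mono) auto
      also have "\<dots> \<le> Suc (card (colors L))" by (simp add: card_insert_if)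
      finally have colS: "card (colors S) \<le> Suc (card (colors L))" .
      have "card (colors U) + card S \<le> card (colors S) + card U"
        by (rule card_colors_extend[OF U(1,2) connS SU])
      moreover have "nbrs U v \<subseteq> nbrs L v \<union> M"
      proof
        fix u assume u: "u \<in> nbrs U v"
        then have "{v, u} \<in> E" "u \<in> U" by (auto simp: nbrs_def insert_commute)
        then show "u \<in> nbrs L v \<union> M"
          using exitL[OF vL] u by (auto simp: nbrs_def M_def)
      qed
      then have "card (nbrs U v) \<le> card (nbrs L v \<union> M)"
        by (rule card_mono[rotated]) (use finL in \<open>auto simp: nbrs_def\<close>)
      then have "card (nbrs U v) \<le> card (nbrs L v) + card M"
        by (rule order.trans[OF _ card_Un_le])
      \<comment> \<open>Passing from \<open>L\<close> to \<open>S\<close> gains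
        \<open>card M + card Z\<close> vertices for at most one color. This cancels the
        \<open>card Z\<close> of \<open>bound_L\<close> and pays for the neighbors in
        \<open>M\<close>; the one color is covered by \<open>card X \<ge> 1\<close>.\<close>
      ultimately show ?thesis using bound_L cardS colS X1 by linarith
    next
      \<comment> \<open>If \<open>v\<close> is a cut vertex, \<open>U - {v}\<close> splits into
        \<open>A\<close> and \<open>B\<close> without edges between them. Induction applies to each
        side together with \<open>v\<close>, using the part of \<open>X\<close> on that side;
        counting \<open>v\<close> twice is balanced by the \<open>1\<close> on the left occurring
        twice.\<close>
      case False
      have "U - {v} \<noteq> {}" using nontriv U(3) by blast
      with False obtain A where A: "A \<subseteq> U - {v}" "A \<noteq> {}" "A \<noteq> U - {v}"
        and noA: "\<forall>x\<in>A. \<forall>y\<in>U - {v} - A. {x, y} \<notin> E"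
        by (rule not_connE)
      define B where "B = U - {v} - A"
      have B: "B \<noteq> {}" "A \<inter> B = {}" "U - {v} = A \<union> B" "v \<notin> A" "v \<notin> B"
        using A by (auto simp: B_def)
      have noAB: "{x, y} \<notin> E" if "x \<in> A" "y \<in> B" for x y using noA that by (simp add: B_def)
      have noBA: "{x, y} \<notin> E" if "x \<in> B" "y \<in> A" for x y
        using noAB[OF that(2,1)] by (simp add: insert_commute)
      have finAB: "finite A" "finite B" using fin finite_subset[OF A(1)] by (auto simp: B_def)
      have cardU: "card U = Suc (card A + card B)"
        using finAB B U by (metis card_Un_disjoint card.remove fin)
      have part: "card (nbrs (insert v D) v) + card (colors (insert v D)) + 1
          \<le> card (insert v D) + card (X \<inter> D)"
        if D: "D \<noteq> {}" "C \<noteq> {}" "U - {v} = C \<union> D" "C \<inter> D = {}" "v \<notin> C" "v \<notin> D"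
          and no: "\<And>x y. x \<in> C \<Longrightarrow> y \<in> D \<Longrightarrow> {x, y} \<notin> E" for C D
      proof (rule IH)
        show "card (insert v D) < card U"
          by (rule psubset_card_mono[OF fin]) (use D U in blast)
        show "conn E (insert v D)" by (rule conn_branch[OF U(1,3) D(3,4) no])
        show "insert v D \<subseteq> V" using D U by blast
        show "X \<inter> D \<subseteq> insert v D - {v}" using D by blast
        fix W assume W: "W \<subseteq> insert v D - {v}" "W \<noteq> {}" "W \<inter> (X \<inter> D) = {}"
        then obtain x y where xy: "x \<in> W" "y \<in> U - {v} - W" "{x, y} \<in> E"
          using hit[of W] D by blast
        have "y \<notin> C" using no[of y x] xy W by (auto simp: insert_commute)
        then show "\<exists>x\<in>W. \<exists>y\<in>insert v D - {v} - W. {x, y} \<in> E" using xy D by blast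
      qed simp
      have pA: "card (nbrs (insert v A) v) + card (colors (insert v A)) + 1
          \<le> Suc (card A) + card (X \<inter> A)"
        using part[of A B] B A noBA finAB by (simp add: Un_commute Int_commute)
      have pB: "card (nbrs (insert v B) v) + card (colors (insert v B)) + 1
          \<le> Suc (card B) + card (X \<inter> B)"
        using part[of B A] B A noAB finAB by simp
      have "colors U \<subseteq> colors (insert v A) \<union> colors (insert v B)"
      proof
        fix c assume "c \<in> colors U"
        then obtain x y where xy: "x \<in> U" "y \<in> U" "{x, y} \<in> E" "\<Gamma> {x, y} = c" by (rule colorsE)
        then have "x \<in> insert v A \<and> y \<in> insert v A \<or> x \<in> insert v B \<and> y \<in> insert v B"
          using noAB[of x y] noBA[of x y] B by blast
        then show "c \<in> colors (insert v A) \<union> colors (insert v B)" using colorsI xy by blast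
      qed
      then have "card (colors U) \<le> card (colors (insert v A) \<union> colors (insert v B))"
        by (intro card_mono) auto
      then have c: "card (colors U) \<le> card (colors (insert v A)) + card (colors (insert v B))"
        by (rule order.trans[OF _ card_Un_le])
      have "nbrs U v \<subseteq> nbrs (insert v A) v \<union> nbrs (insert v B) v"
        using B by (auto simp: nbrs_def)
      then have "card (nbrs U v) \<le> card (nbrs (insert v A) v \<union> nbrs (insert v B) v)"
        by (intro card_mono) (use finAB in \<open>auto simp: nbrs_def\<close>)
      then have d: "card (nbrs U v) \<le> card (nbrs (insert v A) v) + card (nbrs (insert v B) v)"
        by (rule order.trans[OF _ card_Un_le])
      have "X = (X \<inter> A) \<union> (X \<inter> B)" "(X \<inter> A) \<inter> (X \<inter> B) = {}" using X B by blast+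
      then have "card X = card (X \<inter> A) + card (X \<inter> B)"
        using finX by (metis card_Un_disjoint finite_Int)
      then show ?thesis using pA pB c d cardU by linarith
    qed
  qed
qed

text \<open>As \<open>U - {v}\<close> is connected, any single vertex of it serves as the hitting
  set \<open>X\<close>, and \<open>card X = 1\<close> cancels the \<open>1\<close> on the
  left.\<close>

lemma degree_bound:
  assumes "conn E U" "U \<subseteq> V" "v \<in> U" "conn E (U - {v})"
  shows "card (nbrs U v) + card (colors U) \<le> card U"
proof -
  obtain x where x: "x \<in> U - {v}" using conn_nonempty[OF assms(4)] by blast
  have "card (nbrs U v) + card (colors U) + 1 \<le> card U + card {x}"
  proof (rule degree_bound_hitting_set[OF assms(1-3)])
    fix W assume W: "W \<subseteq> U - {v}" "W \<noteq> {}" "W \<inter> {x} = {}"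
    then have "W \<noteq> U - {v}" using x by blast
    then show "\<exists>x\<in>W. \<exists>y\<in>U - {v} - W. {x, y} \<in> E"
      using conn_out_edge[OF assms(4) W(1,2)] by metis
  qed (use x in auto)
  then show ?thesis by simp
qed

text \<open>A color \<open>c\<close> found only at \<open>v\<close> lies on some edge
  \<open>{u, v}\<close>. Any neighbor \<open>w\<close> is joined to \<open>u\<close> inside
  \<open>U - {v}\<close> without \<open>c\<close>; so \<open>{w, v}\<close> also has color
  \<open>c\<close>, or the detour through \<open>w\<close> would bypass \<open>{u, v}\<close>, and
  \<open>color_neighbor_unique\<close> forces \<open>w = u\<close>.\<close>

lemma new_color_degree:
  assumes "conn E (U - {v})" "v \<in> U" "colors U \<noteq> colors (U - {v})"
  shows "card (nbrs U v) \<le> 1"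
proof -
  obtain c where c: "c \<in> colors U" "c \<notin> colors (U - {v})"
    using assms(3) colors_mono[of "U - {v}" U] by blast
  obtain a b where ab: "a \<in> U" "b \<in> U" "{a, b} \<in> E" "\<Gamma> {a, b} = c" using c(1) by (rule colorsE)
  then have "a = v \<or> b = v" using c(2) colorsI[of a "U - {v}" b] by blast
  then have "\<exists>u\<in>U. {u, v} \<in> E \<and> \<Gamma> {u, v} = c" using ab by (auto simp: insert_commute)
  then obtain u where u: "u \<in> U" "{u, v} \<in> E" "\<Gamma> {u, v} = c" by blast
  have "w = u" if w: "w \<in> nbrs U v" for w
  proof -
    have wv: "{w, v} \<in> E" "w \<in> U - {v}" "u \<in> U - {v}"
      using w u edgeD[OF u(2)] edgeD[of w v] by (auto simp: nbrs_def)
    have reach: "reachable {e \<in> E. \<Gamma> e \<noteq> c} u w"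
      using conn_reachable_avoiding[OF assms(1)] wv c by blast
    have "\<Gamma> {w, v} = c"
    proof (rule ccontr)
      assume "\<Gamma> {w, v} \<noteq> c"
      then have "reachable {e \<in> E. \<Gamma> e \<noteq> c} w v" using wv by (auto intro: reachable_edge)
      then show False using edge_separated[OF u(2)] u(3) reachable_trans[OF reach, of v] by simp
    qed
    then show "w = u" using color_neighbor_unique[OF reach u(2,3) wv(1)] by simp
  qed
  then have "nbrs U v \<subseteq> {u}" by blast
  then show ?thesis using card_mono[of "{u}" "nbrs U v"] by simp
qed

section \<open>Counting edges by deleting vertices\<close>

lemma card_induced_delete:
  assumes "v \<in> U" "finite U"
  shows "card (induced E U) \<le> card (induced E (U - {v})) + card (nbrs U v)"
proof -
  have "induced E U \<subseteq> induced E (U - {v}) \<union> (\<lambda>u. {u, v}) ` nbrs U v"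
  proof
    fix e assume e: "e \<in> induced E U"
    then have "e \<in> E" by (simp add: induced_def)
    then obtain x y where xy: "e = {x, y}" by (rule edgeE)
    show "e \<in> induced E (U - {v}) \<union> (\<lambda>u. {u, v}) ` nbrs U v"
    proof (cases "v \<in> e")
      case True
      then obtain u where "e = {u, v}" using xy by blast
      then show ?thesis using e by (auto simp: induced_def nbrs_def)
    next
      case False
      then show ?thesis using e by (auto simp: induced_def)
    qed
  qed
  then have "card (induced E U) \<le> card (induced E (U - {v}) \<union> (\<lambda>u. {u, v}) ` nbrs U v)"
    by (intro card_mono) (use assms finite_E in \<open>auto simp: nbrs_def induced_def\<close>)
  also have "\<dots> \<le> card (induced E (U - {v})) + card ((\<lambda>u. {u, v}) ` nbrs U v)"
    by (rule card_Un_le)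
  also have "card ((\<lambda>u. {u, v}) ` nbrs U v) \<le> card (nbrs U v)"
    by (rule card_image_le) (use assms in \<open>simp add: nbrs_def\<close>)
  finally show ?thesis by simp
qed

text \<open>Induction deletes a vertex that leaves the rest connected. The excess \<open>a\<close>
  of vertices over colors either drops by one at the cost of at most \<open>a\<close> edges,
  matching the growth of the binomial, or stays fixed while one color and at most one edge
  disappear.\<close>

lemma card_induced_bound:
  assumes "conn E U" "U \<subseteq> V" "card U = card (colors U) + a"
  shows "card (induced E U) + 1 \<le> (Suc a choose 2) + card (colors U)"
  using assms
proof (induction "card U" arbitrary: U a rule: less_induct)
  case less
  note IH = less(1) and U = less(2,3) and a = less(4)
  have fin: "finite U" by (rule finite_subset[OF U(2) finite_V])
  show ?case
  proof (cases "card U \<ge> 2")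
    \<comment> \<open>A single vertex carries no color, so \<open>a = 1\<close> and both sides equal
      \<open>1\<close>.\<close>
    case False
    moreover have "card U \<noteq> 0" using conn_nonempty[OF U(1)] fin by simp
    ultimately have "card U = 1" by linarith
    then obtain u where "U = {u}" by (meson card_1_singletonE)
    then have "colors U = {}" by (simp add: colors_singleton)
    moreover then have "induced E U = {}" by (simp add: colors_def)
    ultimately show ?thesis using a \<open>card U = 1\<close> by (simp add: numeral_2_eq_2)
  next
    case True
    obtain v where v: "v \<in> U" "conn E (U - {v})" by (rule conn_delete_vertex[OF fin U(1) True])
    have cU: "card U = Suc (card (U - {v}))" by (rule card.remove[OF fin v(1)])
    have UV: "U - {v} \<subseteq> V" using U by blast
    have less': "card (colors (U - {v})) < card (U - {v})" by (rule card_colors_less[OF v(2) UV])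
    define b where "b = card (U - {v}) - card (colors (U - {v}))"
    have b: "card (U - {v}) = card (colors (U - {v})) + b" using less' by (simp add: b_def)
    have IH': "card (induced E (U - {v})) + 1 \<le> (Suc b choose 2) + card (colors (U - {v}))"
      by (rule IH[OF _ v(2) UV b]) (use cU in simp)
    note del = card_induced_delete[OF v(1) fin]
    show ?thesis
    proof (cases "colors U = colors (U - {v})")
      case True
      have "a = Suc b" using True a b cU by simp
      moreover have "card (nbrs U v) \<le> a" using degree_bound[OF U v] a by linarith
      ultimately show ?thesis using IH' del True by (simp add: numeral_2_eq_2)
    next
      case False
      have "card (colors (U - {v})) < card (colors U)"
        by (rule psubset_card_mono) (use False colors_mono[of "U - {v}" U] in auto)
      moreover have "card (colors U) \<le> Suc (card (colors (U - {v})))"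
        using card_colors_extend[OF U v(2)] cU by simp
      ultimately have k: "card (colors U) = Suc (card (colors (U - {v})))" by linarith
      then have "a = b" using a b cU by simp
      then show ?thesis using IH' del k new_color_degree[OF v(2,1) False] by simp
    qed
  qed
qed

end

section \<open>Edge bounds in terms of \<open>md\<close>\<close>

text \<open>Each increment of \<open>j\<close> raises the binomial by at least \<open>1\<close>.
  Hence, for \<open>k < n\<close>, the bound \<open>((n - k + 1) choose 2) + k\<close> does not grow
  with the number \<open>k\<close> of colors.\<close>

lemma choose2_add_le: "a \<ge> 1 \<Longrightarrow> (Suc a choose 2) + j \<le> (Suc (a + j) choose 2)"
  by (induction j) (auto simp: numeral_2_eq_2)

text \<open>An optimal coloring makes the graph an \<open>md_colored_graph\<close> in which
  \<open>V\<close> carries exactly \<open>md V E\<close> colors; both bounds are then those of the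
  locale for \<open>U = V\<close>.\<close>

lemma md_bounds:
  assumes "simple_graph V E" "connected_graph V E"
  shows md_less_card: "md V E < card V"
    and card_edges_le: "card E + 1 \<le> ((card V - md V E + 1) choose 2) + md V E"
proof -
  obtain \<Gamma> where \<Gamma>: "MD_coloring V E \<Gamma>" "num_colors E \<Gamma> = md V E"
    using md_attained[OF assms(1)] by blast
  interpret md_colored_graph V E \<Gamma>
    by unfold_locales (use assms \<Gamma> MD_coloring_iff in \<open>blast+\<close>)
  have ind: "induced E V = E" using assms(1) by (auto simp: induced_def simple_graph_def)
  have V: "conn E V" using assms(2) by (simp add: conn_def ind)
  have col: "card (colors V) = md V E" using \<Gamma>(2) by (simp add: colors_def ind num_colors_def)
  show less: "md V E < card V" using card_colors_less[OF V] col by simp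
  show "card E + 1 \<le> ((card V - md V E + 1) choose 2) + md V E"
    using card_induced_bound[OF V, of "card V - md V E"] less col ind by simp
qed

lemma card_edges_le_of_md:
  assumes "simple_graph V E" "connected_graph V E" "r < md V E"
  shows "card E \<le> ((card V - r) choose 2) + r"
proof -
  \<comment> \<open>\<open>a\<close> is the excess of vertices over colors and \<open>j\<close>
    counts the colors beyond \<open>r + 1\<close>; the case \<open>j = 0\<close> allows the most
    edges.\<close>
  define a j where "a = card V - md V E" and "j = md V E - Suc r"
  have "a \<ge> 1" "card V - r = Suc (a + j)" "md V E = Suc (r + j)"
    using assms(3) md_less_card[OF assms(1,2)] by (auto simp: a_def j_def)
  then show ?thesis
    using card_edges_le[OF assms(1,2), folded a_def] choose2_add_le[of a j] by simp
qed

section \<open>The extremal graph: a clique with pendant edges\<close>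

definition clique_edges :: "nat \<Rightarrow> nat set set" where
  "clique_edges m = {e. e \<subseteq> {..<m} \<and> card e = 2}"

definition pendant_edges :: "nat \<Rightarrow> nat \<Rightarrow> nat set set" where
  "pendant_edges m n = (\<lambda>i. {0, i}) ` {m..<n}"

lemma inj_pendant: "inj_on (\<lambda>i. {0, i}) {m..<n::nat}"
  by (auto simp: inj_on_def doubleton_eq_iff)

text \<open>One color for the clique and a separate one for each pendant edge make
  \<open>n - m + 1\<close> colors. Every vertex except \<open>0\<close>, where all pendant edges are
  attached, then sees a single color, whose deletion isolates it; of two distinct vertices at least
  one is not \<open>0\<close>.\<close>

lemma extremal_graph:
  fixes m n :: nat
  assumes "2 \<le> m" "m \<le> n"
  defines "E \<equiv> clique_edges m \<union> pendant_edges m n"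
  shows extremal_simple: "simple_graph {..<n} E"
    and extremal_connected: "connected_graph {..<n} E"
    and extremal_card: "card E = (m choose 2) + (n - m)"
    and extremal_md: "Suc (n - m) \<le> md {..<n} E"
proof -
  show simple: "simple_graph {..<n} E"
    using assms by (auto simp: simple_graph_def E_def clique_edges_def pendant_edges_def)
  have zero: "{0, i} \<in> E" if "0 < i" "i < n" for i
    using that assms by (cases "i < m") (auto simp: E_def clique_edges_def pendant_edges_def)
  have reach0: "reachable E 0 i" if "i < n" for i
    using that zero[of i] by (cases "i = 0") (auto intro: reachable_edge)
  show conn: "connected_graph {..<n} E"
    unfolding connected_graph_def
  proof (intro conjI ballI)
    fix u v assume "u \<in> {..<n}" "v \<in> {..<n}"
    then show "reachable E u v" using reach0 reachable_common[of E 0 u v] by simp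
  qed (use assms in \<open>auto simp: lessThan_empty_iff\<close>)
  have "finite (clique_edges m)" by (simp add: clique_edges_def)
  moreover have "clique_edges m \<inter> pendant_edges m n = {}"
    by (auto simp: clique_edges_def pendant_edges_def)
  ultimately show "card E = (m choose 2) + (n - m)"
    by (simp add: E_def card_Un_disjoint pendant_edges_def card_image inj_pendant)
      (simp add: clique_edges_def n_subsets)
  \<comment> \<open>On a pendant edge \<open>Max e\<close> is its leaf, which is at least
    \<open>m \<ge> 2\<close>, so it never clashes with the clique color \<open>1\<close>.\<close>
  define \<Gamma> where "\<Gamma> e = (if Max e < m then 1 else Max e)" for e :: "nat set"
  have pend: "\<Gamma> {0, i} = i" if "m \<le> i" for i using that by (simp add: \<Gamma>_def)
  have clique: "\<Gamma> e = 1" if "e \<in> clique_edges m" for e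
  proof -
    have "e \<noteq> {}" "finite e" using that card.infinite by (fastforce simp: clique_edges_def)+
    then have "Max e \<in> e" by simp
    then show ?thesis using that by (auto simp: \<Gamma>_def clique_edges_def)
  qed
  have "{0, 1} \<in> clique_edges m" using assms by (auto simp: clique_edges_def)
  then have "\<Gamma> ` clique_edges m = {1}" using clique by force
  moreover have "\<Gamma> ` pendant_edges m n = {m..<n}"
    using pend by (force simp: pendant_edges_def image_image)
  ultimately have img: "\<Gamma> ` E = insert 1 {m..<n}" by (simp add: E_def image_Un)
  have "edge_coloring n E \<Gamma>"
    unfolding edge_coloring_def
  proof
    fix e assume "e \<in> E"
    then have "\<Gamma> e \<in> insert 1 {m..<n}" using img by blast
    then show "\<Gamma> e \<in> {1..n}" using assms by auto
  qed
  moreover have isolated: "\<exists>i. \<forall>w. w \<noteq> v \<longrightarrow> \<not> reachable {e \<in> E. \<Gamma> e \<noteq> i} v w" if "v \<noteq> 0" for v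
  proof -
    define i where "i = (if v < m then 1 else v)"
    have star: "\<Gamma> {v, y} = i" if vy: "{v, y} \<in> E" for y
    proof (cases "{v, y} \<in> clique_edges m")
      case True
      then show ?thesis using clique by (auto simp: i_def clique_edges_def)
    next
      case False
      then have "{v, y} \<in> pendant_edges m n" using vy unfolding E_def by blast
      then obtain j where j: "{v, y} = {0, j}" "j \<in> {m..<n}"
        unfolding pendant_edges_def by (rule imageE)
      then have "v = j" using \<open>v \<noteq> 0\<close> by (simp add: doubleton_eq_iff)
      then show ?thesis using j pend by (simp add: i_def)
    qed
    have "w \<in> {v}" if "reachable {e \<in> E. \<Gamma> e \<noteq> i} v w" for w
      using that by (rule reachable_closed) (use star in auto)
    then show ?thesis by blast
  qed
  have "\<exists>i. \<not> reachable {e \<in> E. \<Gamma> e \<noteq> i} u v" if uv: "u \<noteq> v" for u v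
  proof (cases "u = 0")
    case True
    then have "v \<noteq> 0" using uv by simp
    from isolated[OF this] obtain i where "\<not> reachable {e \<in> E. \<Gamma> e \<noteq> i} v u" using uv by blast
    then have "\<not> reachable {e \<in> E. \<Gamma> e \<noteq> i} u v" by (rule contrapos_nn[OF _ reachable_sym])
    then show ?thesis ..
  next
    case False
    from isolated[OF this] show ?thesis using uv[symmetric] by blast
  qed
  ultimately have "MD_coloring {..<n} E \<Gamma>" unfolding MD_coloring_iff[OF conn] by blast
  then have "num_colors E \<Gamma> \<le> md {..<n} E" by (rule num_colors_le_md[OF simple])
  moreover have "num_colors E \<Gamma> = Suc (n - m)" using img assms by (simp add: num_colors_def)
  ultimately show "Suc (n - m) \<le> md {..<n} E" by simp
qed

section \<open>The exact threshold\<close>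

theorem theorem3p3:
  fixes n r :: nat
  assumes "1 \<le> n" and "1 \<le> r" and "r \<le> n - 1"
  shows "md_edge_threshold n r = (
           if r \<le> n - 2 then int ((n - r + 1) choose 2) - int n + 2 * int r + 1
                  else int n - 1)"
proof (cases "r \<le> n - 2")
  case True
  \<comment> \<open>As \<open>r \<ge> 1\<close>, the condition \<open>r \<le> n - 2\<close> excludes
    truncated subtraction and gives \<open>n \<ge> 3\<close>.\<close>
  then have r: "2 \<le> n - r" "r \<le> n" using assms by auto
  have n: "2 \<le> n - r" "n - r \<le> n" "n - (n - r) = r" using r by auto
  \<comment> \<open>One more than the edge bound of \<open>card_edges_le_of_md\<close> for graphs
    with \<open>md\<close> above \<open>r\<close>; Pascal's rule turns it into the stated
    formula.\<close>
  define m where "m = int ((n - r) choose 2) + int r + 1"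
  have "(n - r + 1) choose 2 = ((n - r) choose 2) + (n - r)" by (simp add: numeral_2_eq_2)
  then have m: "int ((n - r + 1) choose 2) - int n + 2 * int r + 1 = m"
    using r by (simp add: m_def of_nat_diff)
  \<comment> \<open>The threshold is a minimum over values from \<open>n - 1\<close> on, so
    \<open>m\<close> has to be shown admissible.\<close>
  have "n - r - 1 \<le> (n - r) choose 2"
    using choose2_add_le[of 1 "n - r - 2"] r by (simp add: numeral_2_eq_2 Suc_diff_Suc)
  then have ge: "m \<ge> int n - 1" using r by (simp add: m_def)
  have bound: "edge_bound n r m"
    unfolding edge_bound_def
  proof (intro allI impI, rule ccontr)
    fix V :: "nat set" and E
    assume *: "simple_graph V E \<and> connected_graph V E \<and> card V = n \<and> m \<le> int (card E)"
      and "\<not> md V E \<le> r"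
    then have "card E \<le> ((n - r) choose 2) + r" using card_edges_le_of_md[of V E r] by simp
    then show False using * by (simp add: m_def)
  qed
  have "m \<le> md_edge_threshold n r"
  proof (rule ccontr)
    assume "\<not> ?thesis"
    then have small: "md_edge_threshold n r \<le> int (((n - r) choose 2) + r)" by (simp add: m_def)
    \<comment> \<open>A clique of order \<open>n - r\<close> with \<open>r\<close> pendant edges has
      exactly \<open>m - 1\<close> edges but \<open>md \<ge> r + 1\<close>, so no value below
      \<open>m\<close> works.\<close>
    let ?E = "clique_edges (n - r) \<union> pendant_edges (n - r) n"
    have "md {..<n} ?E \<le> r"
      using md_edge_threshold_least(2)[of n r] extremal_simple[OF n(1,2)]
        extremal_connected[OF n(1,2)] extremal_card[OF n(1,2)] small n(3)
      unfolding edge_bound_def by simp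
    then show False using extremal_md[OF n(1,2)] n(3) by simp
  qed
  then have "md_edge_threshold n r = m"
    using md_edge_threshold_least(3)[OF ge bound] by simp
  then show ?thesis using True m by simp
next
  case False
  \<comment> \<open>Here \<open>r = n - 1\<close>, and \<open>md V E < n\<close> holds for every
    connected graph of order \<open>n\<close>, so the least admissible value already works.\<close>
  have "edge_bound n r (int n - 1)"
    unfolding edge_bound_def
  proof (intro allI impI)
    fix V :: "nat set" and E
    assume *: "simple_graph V E \<and> connected_graph V E \<and> card V = n \<and> int n - 1 \<le> int (card E)"
    then have "md V E < n" using md_less_card by metis
    then show "md V E \<le> r" using False by linarith
  qed
  then have "md_edge_threshold n r = int n - 1"
    using md_edge_threshold_least(1)[of n r] md_edge_threshold_least(3)[of n "int n - 1" r]
    by simp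
  then show ?thesis using False by simp
qed

end
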